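(* Let $k$ be a positive integer. For every permutation $\sigma\in S_k$ and every nonnegative integer $g$, $$(k-1)^g\,\#P(\sigma,|\sigma|)\;\le\;\#P(\sigma,|\sigma|+2g)\;\le\;(6k^{7/2})^g\,\#P(\sigma,|\sigma|).$$
   Context: For $\sigma\in S_k$, $|\sigma|=k-(\text{number of cycles of }\sigma)$. The unitary Weingarten graph is the directed graph with vertex set $\bigsqcup_{k\ge0}S_k$ ($S_0=\{\emptyset\}$; vertices in $S_k$ have level $k$), with a solid arrow $\sigma\to(i,k)\sigma$ for each $\sigma\in S_k$, $k\ge2$, and each $1\le i<k$ (here $(i,k)$ is a transposition), and a dashed arrow $\sigma\dashrightarrow\sigma^{\downarrow}$ whenever $\sigma\in S_k$, $k\ge1$, satisfies $\sigma(k)=k$, where $\sigma^{\downarrow}\in S_{k-1}$ is the restriction of $\sigma$ to $\{1,\dots,k-1\}$. For $\sigma\in S_k$ and $l\ge0$, $P(\sigma,l)$ is the set of paths $(\sigma_0=\sigma,\sigma_1,\dots,\sigma_{l+k}=\emptyset)$ in which each consecutive pair is joined by an arrow $\sigma_{i-1}\to\sigma_i$ or $\sigma_{i-1}\dashrightarrow\sigma_i$; such a path uses exactly $k$ dashed and $l$ solid arrows. *)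

theory Defs
  imports Complex_Main "HOL-Combinatorics.Orbits"
begin

text \<open>
  A permutation of \<^term>\<open>{1..k}\<close> is a function on \<^typ>\<open>nat\<close> that is the identity outside
  \<^term>\<open>{1..k}\<close>, so one function represents permutations in several symmetric groups.
  A vertex of the Weingarten graph therefore carries its level: \<open>(k, s)\<close> stands for the element
  \<open>s\<close> of \<open>S\<^sub>k\<close>. The only vertex of level 0 is \<open>(0, id)\<close>.
\<close>

type_synonym vertex = "nat \<times> (nat \<Rightarrow> nat)"

definition weingarten_vertices :: "vertex set" where
  "weingarten_vertices = {(k, s). s permutes {1..k}}"

inductive solid_arrow :: "vertex \<Rightarrow> vertex \<Rightarrow> bool" where
  "\<lbrakk>s permutes {1..k}; 2 \<le> k; 1 \<le> i; i < k\<rbrakk>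
    \<Longrightarrow> solid_arrow (k, s) (k, transpose i k \<circ> s)"

inductive dashed_arrow :: "vertex \<Rightarrow> vertex \<Rightarrow> bool" where
  "\<lbrakk>s permutes {1..k}; 1 \<le> k; s k = k\<rbrakk>
    \<Longrightarrow> dashed_arrow (k, s) (k - 1, restrict_id s {1..k - 1})"

definition weingarten_arrow :: "vertex \<Rightarrow> vertex \<Rightarrow> bool" where
  "weingarten_arrow u v \<longleftrightarrow> solid_arrow u v \<or> dashed_arrow u v"

text \<open>
  The graph has no parallel arrows (solid arrows preserve the level, dashed ones lower it, and
  \<open>transpose i k \<circ> s\<close> determines \<open>i\<close>), so a path is determined by its vertices.
\<close>

definition weingarten_paths :: "nat \<Rightarrow> (nat \<Rightarrow> nat) \<Rightarrow> nat \<Rightarrow> vertex list set" where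
  "weingarten_paths k s l =
     {p. length p = l + k + 1 \<and> set p \<subseteq> weingarten_vertices \<and> hd p = (k, s) \<and>
         last p = (0, id) \<and> successively weingarten_arrow p}"

text \<open>Fixed points count as cycles.\<close>

definition num_cycles :: "nat \<Rightarrow> (nat \<Rightarrow> nat) \<Rightarrow> nat" where
  "num_cycles k s = card {C. C \<subseteq> {1..k} \<and> cyclic_on s C}"

definition perm_length :: "nat \<Rightarrow> (nat \<Rightarrow> nat) \<Rightarrow> nat" where
  "perm_length k s = k - num_cycles k s"

text \<open>
  The path sets are finite, and there are at most \<open>k\<close> cycles, so neither \<^const>\<open>card\<close> nor
  the subtraction on \<^typ>\<open>nat\<close> takes a default value.
\<close>

lemma weingarten_arrow_level:
  assumes "weingarten_arrow u v"
  shows "fst v \<le> fst u"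
  using assms by (auto simp: weingarten_arrow_def elim!: solid_arrow.cases dashed_arrow.cases)

lemma successively_weingarten_level:
  assumes "successively weingarten_arrow p" "v \<in> set p"
  shows "fst v \<le> fst (hd p)"
  using assms
proof (induction p)
  case (Cons u p)
  show ?case
  proof (cases "v = u")
    case False
    with Cons.prems have "p \<noteq> []" "v \<in> set p" by auto
    with Cons have "fst v \<le> fst (hd p)" "weingarten_arrow u (hd p)"
      by (auto simp: successively_Cons)
    then show ?thesis using weingarten_arrow_level by fastforce
  qed simp
qed simp

lemma finite_weingarten_paths: "finite (weingarten_paths k s l)"
proof (rule finite_subset)
  let ?V = "Sigma {..k} (\<lambda>j. {s. s permutes {1..j}})"
  show "weingarten_paths k s l \<subseteq> {p. set p \<subseteq> ?V \<and> length p = l + k + 1}"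
    using successively_weingarten_level
    by (fastforce simp: weingarten_paths_def weingarten_vertices_def)
  show "finite {p. set p \<subseteq> ?V \<and> length p = l + k + 1}"
    by (intro finite_lists_length_eq finite_SigmaI finite_permutations) auto
qed

lemma num_cycles_le:
  shows "num_cycles k s \<le> k"
proof -
  have "{C. C \<subseteq> {1..k} \<and> cyclic_on s C} \<subseteq> orbit s ` {1..k}"
    by (auto simp: cyclic_on_def)
  then have "num_cycles k s \<le> card (orbit s ` {1..k})"
    unfolding num_cycles_def by (intro card_mono) auto
  also have "\<dots> \<le> k"
    using card_image_le[of "{1..k}" "orbit s"] by simp
  finally show ?thesis .
qed

end

theory Submission
  imports Defs "HOL-Computational_Algebra.Formal_Power_Series"
begin

text \<open>
  Write \<open>w(\<sigma>) = k + |\<sigma>|\<close> (\<open>rank\<close> below). A dashed arrow lowers \<open>w\<close> by 1, and a solid arrow \<open>\<sigma> \<rightarrow> (i,k)\<sigma>\<close> changes it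
  by \<open>-1\<close> or \<open>+1\<close>, according to whether the transposition splits the cycle of \<open>k\<close> or merges it
  with another one. The shortest paths from \<open>\<sigma>\<close> to \<open>\<emptyset>\<close> therefore have \<open>w(\<sigma>)\<close> steps, and by the
  Catalan recursion their number is the product of the Catalan numbers \<open>Cat(|C| - 1)\<close> over the
  cycles \<open>C\<close> of \<open>\<sigma>\<close>.

  Upper bound: merging two cycles multiplies this product by at most \<open>2 k\<^sup>3\<^sup>/\<^sup>2\<close>. For \<open>g > 0\<close> split a
  path with \<open>w(\<sigma>) + 2g\<close> steps at its first merging step. There are at most \<open>w(\<sigma>) \<le> 2k\<close> positions
  for that step and fewer than \<open>k\<close> choices of \<open>i\<close>, and the rest of the path has only \<open>g - 1\<close>
  further merging steps, so that each unit of \<open>g\<close> costs a factor of at most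
  \<open>2k \<cdot> k \<cdot> 2 k\<^sup>3\<^sup>/\<^sup>2 \<le> 6 k\<^sup>7\<^sup>/\<^sup>2\<close>.

  Lower bound: prefix a path with the detour \<open>\<sigma> \<rightarrow> (i,k)\<sigma> \<rightarrow> \<sigma>\<close>, for which there are \<open>k - 1\<close> choices.
\<close>

section \<open>Cycles of a permutation multiplied by a transposition\<close>

lemma cycles_eq_orbits:
  fixes k :: nat
  assumes "s permutes {1..k}"
  shows "{C. C \<subseteq> {1..k} \<and> cyclic_on s C} = orbit s ` {1..k}"
proof (intro equalityI subsetI)
  fix C assume "C \<in> orbit s ` {1..k}"
  then show "C \<in> {C. C \<subseteq> {1..k} \<and> cyclic_on s C}"
    using permutes_orbit_subset[OF assms] cyclic_on_orbit[OF assms] by blast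
qed (auto simp: cyclic_on_def)

text \<open>Recasts facts about \<open>funpow_dist1\<close>, the first return time to
  \<open>x\<close>, in terms of the orbit's cardinality, so that cycle lengths can be read off as
  cards.\<close>

lemma orbit_funpow_card:
  assumes "permutation s"
  shows "(s ^^ card (orbit s x)) x = x"
    and "inj_on (\<lambda>m. (s ^^ m) x) {..<card (orbit s x)}"
    and "orbit s x = (\<lambda>m. (s ^^ m) x) ` {..<card (orbit s x)}"
proof -
  have x: "x \<in> orbit s x"
    using assms by (rule permutation_self_in_orbit)
  have inj: "inj_on (\<lambda>m. (s ^^ m) x) {..<funpow_dist1 s x x}"
    using inj_on_funpow_dist1[OF x] by (simp add: atLeast0LessThan)
  have orb: "orbit s x = (\<lambda>m. (s ^^ m) x) ` {..<funpow_dist1 s x x}"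
    using orbit_conv_funpow_dist1[OF x] by (simp add: atLeast0LessThan)
  then have card: "card (orbit s x) = funpow_dist1 s x x"
    using card_image[OF inj] by simp
  show "(s ^^ card (orbit s x)) x = x"
    unfolding card using x by (rule funpow_dist1_prop)
  show "inj_on (\<lambda>m. (s ^^ m) x) {..<card (orbit s x)}"
    unfolding card by (rule inj)
  show "orbit s x = (\<lambda>m. (s ^^ m) x) ` {..<card (orbit s x)}"
    unfolding card by (rule orb)
qed

text \<open>\<open>t\<close> differs from \<open>s\<close> only at the predecessors of
  \<open>x\<close> and \<open>i\<close>, whose images are exchanged. The cycle of \<open>x\<close>
  is thereby cut at \<open>i\<close> into two arcs that close up separately.\<close>

lemma orbit_transpose_comp:
  assumes s: "permutation s" and j: "0 < j" "j < card (orbit s x)" and i: "i = (s ^^ j) x"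
  defines "t \<equiv> transpose i x \<circ> s"
  shows "orbit t x = (\<lambda>m. (s ^^ m) x) ` {..<j}"
    and "orbit t i = (\<lambda>m. (s ^^ m) x) ` {j..<card (orbit s x)}"
proof -
  let ?n = "card (orbit s x)"
  have neq: "(s ^^ m) x \<noteq> (s ^^ m') x" if "m < ?n" "m' < ?n" "m \<noteq> m'" for m m'
    using orbit_funpow_card(2)[OF s, of x] that by (auto simp: inj_on_def)
  have t_eq: "t y = s y" if "s y \<noteq> x" "s y \<noteq> i" for y
    using that by (simp add: t_def transpose_def)
  have 1: "(t ^^ m) x = (s ^^ m) x" if "m < j" for m
    using that
  proof (induction m)
    case (Suc m)
    then show ?case
      using neq[of "Suc m" 0] neq[of "Suc m" j] j by (simp add: t_eq i)
  qed simp
  \<comment> \<open>The point at index \<open>j'\<close> precedes \<open>i\<close> under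
    \<open>s\<close>; \<open>t\<close> sends it back to \<open>x\<close>, closing the first
    arc.\<close>
  obtain j' where j': "j = Suc j'"
    using j by (cases j) auto
  then have "(t ^^ j) x = t ((s ^^ j') x)"
    using 1[of j'] by simp
  also have "\<dots> = x"
    using i j' by (simp add: t_def)
  finally have "(t ^^ j) x = x" .
  then have "orbit t x = {(t ^^ m) x |m. m < j}"
    using j by (intro orbit_altdef_bounded)
  also have "\<dots> = (\<lambda>m. (t ^^ m) x) ` {..<j}"
    by auto
  also have "\<dots> = (\<lambda>m. (s ^^ m) x) ` {..<j}"
    using 1 by (intro image_cong) auto
  finally show "orbit t x = (\<lambda>m. (s ^^ m) x) ` {..<j}" .
  have 2: "(t ^^ m) i = (s ^^ (j + m)) x" if "j + m < ?n" for m
    using that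
  proof (induction m)
    case (Suc m)
    then show ?case
      using neq[of "Suc (j + m)" 0] neq[of "Suc (j + m)" j] j by (simp add: t_eq i)
  qed (simp add: i)
  obtain n' where n': "?n = Suc (j + n')"
    using less_imp_Suc_add[OF j(2)] by auto
  then have "(t ^^ (?n - j)) i = t ((s ^^ (j + n')) x)"
    using 2[of n'] by simp
  also have "\<dots> = i"
    using orbit_funpow_card(1)[OF s, of x] n' by (simp add: t_def)
  finally have "(t ^^ (?n - j)) i = i" .
  then have "orbit t i = {(t ^^ m) i |m. m < ?n - j}"
    using j by (intro orbit_altdef_bounded) auto
  also have "\<dots> = (\<lambda>m. (t ^^ m) i) ` {..<?n - j}"
    by auto
  also have "\<dots> = (\<lambda>m. (s ^^ (j + m)) x) ` {..<?n - j}"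
    using 2 by (intro image_cong) auto
  also have "\<dots> = (\<lambda>m. (s ^^ m) x) ` ((+) j ` {..<?n - j})"
    by (simp add: image_image)
  also have "(+) j ` {..<?n - j} = {j..<?n}"
    unfolding lessThan_atLeast0 image_add_atLeastLessThan using j by simp
  finally show "orbit t i = (\<lambda>m. (s ^^ m) x) ` {j..<?n}" .
qed

lemma card_orbit_transpose_comp:
  assumes "permutation s" "0 < j" "j < card (orbit s x)" "i = (s ^^ j) x"
  shows "card (orbit (transpose i x \<circ> s) x) = j"
    and "card (orbit (transpose i x \<circ> s) i) = card (orbit s x) - j"
proof -
  note inj = orbit_funpow_card(2)[OF assms(1), of x]
  show "card (orbit (transpose i x \<circ> s) x) = j"
    unfolding orbit_transpose_comp(1)[OF assms]
    using assms by (subst card_image) (auto intro: inj_on_subset[OF inj])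
  show "card (orbit (transpose i x \<circ> s) i) = card (orbit s x) - j"
    unfolding orbit_transpose_comp(2)[OF assms]
    using assms by (subst card_image) (auto intro: inj_on_subset[OF inj])
qed

text \<open>Off the cycle of \<open>x\<close> the two permutations agree, so their other cycles form
  a common set \<open>R\<close>. The \<open>insert\<close> form with non-membership is what
  evaluates both cards and products.\<close>

lemma orbits_transpose_comp:
  assumes A: "s permutes A" "finite A" and x: "x \<in> A"
    and j: "0 < j" "j < card (orbit s x)" and i: "i = (s ^^ j) x"
  defines "t \<equiv> transpose i x \<circ> s"
  obtains R where "finite R" "orbit s ` A = insert (orbit s x) R" "orbit s x \<notin> R"
    "orbit t ` A = insert (orbit t x) (insert (orbit t i) R)"
    "orbit t x \<notin> insert (orbit t i) R" "orbit t i \<notin> R"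
proof
  have s: "permutation s"
    using A by (auto simp: permutation_permutes)
  have i_orb: "i \<in> orbit s x"
    unfolding i using permutation_self_in_orbit[OF s] by (rule funpow_in_orbit)
  have sub: "orbit s x \<subseteq> A"
    using A x by (intro permutes_orbit_subset)
  then have "i \<in> A"
    using i_orb by auto
  then have "t permutes A"
    unfolding t_def using A x by (intro permutes_compose permutes_swap_id)
  then have t: "permutation t"
    using A by (auto simp: permutation_permutes)
  have x_in: "x \<in> orbit t x" and i_in: "i \<in> orbit t i"
    using t by (auto intro: permutation_self_in_orbit)
  have disj: "orbit s y \<inter> orbit s x = {}" if "y \<notin> orbit s x" for y
    using that orbit_swap[OF permutation_self_in_orbit[OF s]] orbit_trans by fastforce
  have same: "orbit t y = orbit s y" if y: "y \<notin> orbit s x" for y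
  proof (rule orbit_cong)
    show "y \<in> orbit s y"
      using s by (rule permutation_self_in_orbit)
    fix z assume "z \<in> orbit s y"
    then have "s z \<in> orbit s y"
      by (rule orbit.step)
    \<comment> \<open>Only points whose image under \<open>s\<close> is \<open>x\<close> or
      \<open>i\<close> are affected by the transposition, and these lie in the cycle of
      \<open>x\<close>.\<close>
    then have "s z \<notin> orbit s x"
      using disj[OF y] by auto
    then have "s z \<noteq> x" "s z \<noteq> i"
      using i_orb permutation_self_in_orbit[OF s] by auto
    then show "t z = s z"
      by (simp add: t_def transpose_def)
  qed
  note orbs = orbit_transpose_comp[OF s j i, folded t_def]
  have un: "orbit s x = orbit t x \<union> orbit t i"
    unfolding orbs using j orbit_funpow_card(3)[OF s, of x]
    by (metis image_Un ivl_disj_un_one(2) less_imp_le)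
  have ne: "orbit t x \<noteq> orbit t i"
  proof
    assume "orbit t x = orbit t i"
    then have "i \<in> (\<lambda>m. (s ^^ m) x) ` {..<j}"
      using i_in orbs by auto
    then obtain m where "m < j" "(s ^^ m) x = (s ^^ j) x"
      using i by auto
    then show False
      using orbit_funpow_card(2)[OF s, of x] j by (auto simp: inj_on_def)
  qed
  let ?R = "orbit s ` (A - orbit s x)"
  show "finite ?R"
    using A by simp
  have "orbit s ` orbit s x = {orbit s x}"
    using orbit_cyclic_eq3[OF cyclic_on_orbit'[OF s]] permutation_self_in_orbit[OF s] by blast
  then show "orbit s ` A = insert (orbit s x) ?R"
    using sub by (metis Diff_partition image_Un insert_is_Un)
  show "orbit s x \<notin> ?R"
    using permutation_self_in_orbit[OF s] by auto
  have "orbit t ` orbit t y = {orbit t y}" for y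
    using orbit_cyclic_eq3[OF cyclic_on_orbit'[OF t]] permutation_self_in_orbit[OF t] by blast
  then have "orbit t ` orbit s x = {orbit t x, orbit t i}"
    unfolding un image_Un by auto
  moreover have "orbit t ` (A - orbit s x) = ?R"
    using same by (auto simp: image_iff)
  ultimately show "orbit t ` A = insert (orbit t x) (insert (orbit t i) ?R)"
    using sub by (metis Diff_partition image_Un insert_is_Un Un_assoc)
  have "B \<inter> orbit s x = {}" if "B \<in> ?R" for B
    using that disj by auto
  then show "orbit t x \<notin> insert (orbit t i) ?R" "orbit t i \<notin> ?R"
    using ne un x_in i_in by blast+
qed

text \<open>If the \<open>t\<close>-cycle of \<open>x\<close> missed \<open>i\<close>, then
  \<open>s\<close>, being the transposition after \<open>t\<close>, would follow that cycle until
  \<open>t\<close> returns to \<open>x\<close> and would land on \<open>i\<close> instead, against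
  the assumption.\<close>

lemma in_orbit_transpose_comp:
  assumes t: "permutation (transpose i x \<circ> s)" and i: "i \<notin> orbit s x"
  shows "i \<in> orbit (transpose i x \<circ> s) x"
proof (rule ccontr)
  define t where "t = transpose i x \<circ> s"
  assume "i \<notin> orbit (transpose i x \<circ> s) x"
  then have not_i: "(t ^^ m) x \<noteq> i" for m
    using funpow_in_orbit[OF permutation_self_in_orbit[OF t]] t_def by metis
  define n where "n = card (orbit t x)"
  have t': "permutation t"
    using assms t_def by simp
  have n: "n \<noteq> 0" "(t ^^ n) x = x"
    using orbit_funpow_card(1)[OF t', of x] finite_orbit[OF permutation_self_in_orbit[OF t'], of x]
    by (auto simp: n_def orbit_nonempty)
  have neq: "(t ^^ m) x \<noteq> x" if "0 < m" "m < n" for m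
    using orbit_funpow_card(2)[OF t', of x] that unfolding n_def
    by (metis funpow_0 gr_implies_not0 inj_onD lessThan_iff less_trans)
  have st: "s = transpose i x \<circ> t"
    by (simp add: t_def comp_assoc[symmetric])
  have *: "(s ^^ m) x = (t ^^ m) x" if "m < n" for m
    using that
  proof (induction m)
    case (Suc m)
    have "(s ^^ Suc m) x = s ((t ^^ m) x)"
      using Suc by simp
    also have "\<dots> = transpose i x ((t ^^ Suc m) x)"
      by (subst st) simp
    finally have "(s ^^ Suc m) x = transpose i x ((t ^^ Suc m) x)" .
    then show ?case
      using neq[of "Suc m"] not_i[of "Suc m"] Suc.prems by (simp add: transpose_def)
  qed simp
  obtain m where m: "n = Suc m"
    using n by (cases n) auto
  have "(s ^^ n) x = s ((t ^^ m) x)"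
    using *[of m] m by simp
  also have "\<dots> = transpose i x ((t ^^ n) x)"
    by (subst st) (simp add: m)
  finally have "(s ^^ n) x = transpose i x ((t ^^ n) x)" .
  then have "(s ^^ n) x = i"
    using n by simp
  then show False
    using i n unfolding orbit_altdef by auto
qed

definition cycle_prod :: "(nat \<Rightarrow> real) \<Rightarrow> ('a \<Rightarrow> 'a) \<Rightarrow> 'a set \<Rightarrow> real" where
  "cycle_prod f s A = (\<Prod>C\<in>orbit s ` A. f (card C))"

text \<open>The common cycles \<open>R\<close> contribute the same factor to both products. The
  cross-multiplied form avoids division, so \<open>f\<close> is arbitrary here.\<close>

lemma split_cycle:
  assumes "s permutes A" "finite A" "x \<in> A" "0 < j" "j < card (orbit s x)" "i = (s ^^ j) x"
  shows "card (orbit (transpose i x \<circ> s) ` A) = Suc (card (orbit s ` A))"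
    and "f (card (orbit s x)) * cycle_prod f (transpose i x \<circ> s) A
      = f j * f (card (orbit s x) - j) * cycle_prod f s A"
proof -
  let ?t = "transpose i x \<circ> s"
  obtain R where R: "finite R" "orbit s ` A = insert (orbit s x) R" "orbit s x \<notin> R"
    "orbit ?t ` A = insert (orbit ?t x) (insert (orbit ?t i) R)"
    "orbit ?t x \<notin> insert (orbit ?t i) R" "orbit ?t i \<notin> R"
    using orbits_transpose_comp[OF assms] by metis
  have "permutation s"
    using assms by (auto simp: permutation_permutes)
  note c = card_orbit_transpose_comp[OF this assms(4-6)]
  show "card (orbit ?t ` A) = Suc (card (orbit s ` A))"
    unfolding R(2,4) using R(1,3,5,6) by simp
  show "f (card (orbit s x)) * cycle_prod f ?t A
      = f j * f (card (orbit s x) - j) * cycle_prod f s A"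
    unfolding cycle_prod_def R(2,4) using R(1,3,5,6)
    by (simp only: prod.insert finite_insert c mult_ac not_False_eq_True)
qed

text \<open>The transposition is an involution, so merging is splitting read backwards:
  \<open>split_cycle\<close> is applied to the product \<open>t\<close>, whose cycle through
  \<open>x\<close> contains \<open>i\<close>. The witnesses \<open>a\<close> and \<open>b\<close>
  are the lengths of the two cycles of \<open>s\<close> that get merged.\<close>

lemma merge_cycles:
  assumes s: "s permutes A" "finite A" and x: "x \<in> A" and i: "i \<in> A" "i \<notin> orbit s x"
  shows "Suc (card (orbit (transpose i x \<circ> s) ` A)) = card (orbit s ` A)"
    and "\<exists>a b. 0 < a \<and> 0 < b \<and> a + b \<le> card A \<and>
      f (a + b) * cycle_prod f s A = f a * f b * cycle_prod f (transpose i x \<circ> s) A"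
proof -
  define t where "t = transpose i x \<circ> s"
  have t: "t permutes A"
    unfolding t_def using s x i by (intro permutes_compose permutes_swap_id)
  then have perm: "permutation t"
    using s by (auto simp: permutation_permutes)
  have "i \<in> orbit t x"
    unfolding t_def using perm i by (intro in_orbit_transpose_comp) (auto simp: t_def)
  then obtain j where j: "j < card (orbit t x)" "i = (t ^^ j) x"
    using orbit_funpow_card(3)[OF perm, of x] by auto
  have "permutation s"
    using s by (auto simp: permutation_permutes)
  then have "i \<noteq> x"
    using i permutation_self_in_orbit by metis
  then have "0 < j"
    using j by (cases j) auto
  have s_eq: "transpose i x \<circ> t = s"
    by (simp add: t_def comp_assoc[symmetric])
  note split = split_cycle[OF t s(2) x \<open>0 < j\<close> j, unfolded s_eq]
  show "Suc (card (orbit (transpose i x \<circ> s) ` A)) = card (orbit s ` A)"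
    using split(1) t_def by simp
  have "card (orbit t x) \<le> card A"
    using s x t by (intro card_mono permutes_orbit_subset)
  then show "\<exists>a b. 0 < a \<and> 0 < b \<and> a + b \<le> card A \<and>
      f (a + b) * cycle_prod f s A = f a * f b * cycle_prod f (transpose i x \<circ> s) A"
    using split(2)[of f] j(1) \<open>0 < j\<close>
    by (intro exI[of _ j] exI[of _ "card (orbit t x) - j"]) (auto simp: t_def)
qed

section \<open>Catalan numbers\<close>

text \<open>Defined by the ratio of consecutive terms, on which the growth bounds are plain
  inductions; the convolution recursion is derived from the binomial form.\<close>

fun catalan :: "nat \<Rightarrow> real" where
  "catalan 0 = 1"
| "catalan (Suc n) = catalan n * (4 * real n + 2) / (real n + 2)"

lemma catalan_pos: "catalan n > 0"
  by (induction n) auto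

text \<open>The generating function is \<open>(1 - sqrt (1 - 4 * x)) / (2 * x)\<close>.\<close>

lemma catalan_gbinomial: "catalan n = - (1 / 2) * (-4) ^ Suc n * ((1 / 2) gchoose Suc n)"
proof (induction n)
  case (Suc n)
  have "(real n + 2) * ((1 / 2) gchoose Suc (Suc n)) = (1 / 2 - real (Suc n)) * ((1 / 2) gchoose Suc n)"
    using gbinomial_mult_1[of "1 / 2 :: real" "Suc n"] by (simp add: algebra_simps)
  then have *: "((1 / 2) gchoose Suc (Suc n)) = (1 / 2 - real (Suc n)) * ((1 / 2) gchoose Suc n) / (real n + 2)"
    by (simp add: field_simps)
  have "- (1 / 2) * (-4) ^ Suc (Suc n) * ((1 / 2) gchoose Suc (Suc n))
      = - (1 / 2) * (-4) ^ Suc n * ((1 / 2) gchoose Suc n) * (-4 * (1 / 2 - real (Suc n))) / (real n + 2)"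
  proof -
    have "- (1 / 2) * (-4) ^ Suc (Suc n) * (c * G / d) = - (1 / 2) * (-4) ^ Suc n * G * (-4 * c) / d"
      for c d G :: real
      by simp
    then show ?thesis
      unfolding * .
  qed
  also have "-4 * (1 / 2 - real (Suc n)) = 4 * real n + 2"
    by simp
  also have "- (1 / 2) * (-4) ^ Suc n * ((1 / 2) gchoose Suc n) * (4 * real n + 2) / (real n + 2)
      = catalan (Suc n)"
    unfolding Suc[symmetric] by simp
  finally show ?case ..
qed simp

text \<open>The square of \<open>sqrt (1 - 4 * x)\<close> is linear, so its coefficients of degree
  at least 2 vanish. This is Vandermonde's identity for 1/2 + 1/2 = 1, up to powers of -4.\<close>

lemma catalan_Suc_convolution: "catalan (Suc n) = (\<Sum>i\<le>n. catalan i * catalan (n - i))"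
proof -
  define g :: "nat \<Rightarrow> real" where "g m = (1 / 2) gchoose m" for m
  have "0 = (\<Sum>i=0..Suc (Suc n). g i * g (Suc (Suc n) - i))"
    using gbinomial_Vandermonde[of "1 / 2 :: real" "1 / 2" "Suc (Suc n)"]
    using binomial_gbinomial[of 1 "Suc (Suc n)", where 'a = real] by (simp add: g_def)
  \<comment> \<open>The two end terms are split off, using \<open>g 0 = 1\<close>; what remains is
    the convolution.\<close>
  also have "\<dots> = 2 * g (Suc (Suc n)) + (\<Sum>i\<le>n. g (Suc i) * g (Suc n - i))"
    unfolding atLeast0AtMost
    by (subst sum.atMost_Suc_shift, subst sum.atMost_Suc) (simp add: g_def)
  finally have *: "(\<Sum>i\<le>n. g (Suc i) * g (Suc n - i)) = - 2 * g (Suc (Suc n))"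
    by simp
  have "catalan i * catalan (n - i) = (1 / 4) * (-4) ^ (n + 2) * (g (Suc i) * g (Suc n - i))"
    if "i \<le> n" for i
  proof -
    have "(-4 :: real) ^ Suc i * (-4) ^ Suc (n - i) = (-4) ^ (n + 2)"
      using that by (simp add: power_add[symmetric] del: power_Suc)
    then show ?thesis
      using that unfolding catalan_gbinomial g_def by (simp add: Suc_diff_le del: power_Suc)
  qed
  then have "(\<Sum>i\<le>n. catalan i * catalan (n - i))
      = (1 / 4) * (-4) ^ (n + 2) * (\<Sum>i\<le>n. g (Suc i) * g (Suc n - i))"
    by (simp add: sum_distrib_left)
  also have "\<dots> = catalan (Suc n)"
    unfolding * by (simp add: catalan_gbinomial g_def del: catalan.simps)
  finally show ?thesis ..
qed

text \<open>Says that \<open>catalan n\<close> is at most 4^n / (n+1)^(3/2); squaring turns each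
  induction step into a polynomial inequality.\<close>

lemma catalan_upper: "(catalan n)\<^sup>2 * (real n + 1) ^ 3 \<le> 16 ^ n"
proof (induction n)
  case (Suc n)
  have "(catalan (Suc n))\<^sup>2 * (real (Suc n) + 1) ^ 3
      = (catalan n)\<^sup>2 * ((4 * real n + 2)\<^sup>2 * (real n + 2))"
    by (simp add: divide_simps power2_eq_square power3_eq_cube add_ac)
  also have "(4 * real n + 2)\<^sup>2 * (real n + 2) \<le> 16 * (real n + 1) ^ 3"
    by (simp add: power2_eq_square power3_eq_cube algebra_simps)
  also have "(catalan n)\<^sup>2 * (16 * (real n + 1) ^ 3) \<le> 16 ^ Suc n"
    using Suc by simp
  finally show ?case
    by (simp add: mult_left_mono)
qed simp

text \<open>Squared form of the bound 4^n / sqrt (4n+1) for the central binomial coefficient. The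
  factor 4n+1 carries the induction; the coarser 4(n+1) applied later would not.\<close>

lemma catalan_lower: "16 ^ n \<le> (catalan n)\<^sup>2 * (real n + 1)\<^sup>2 * (4 * real n + 1)"
proof (induction n)
  case (Suc n)
  have "16 ^ Suc n \<le> 16 * ((catalan n)\<^sup>2 * (real n + 1)\<^sup>2 * (4 * real n + 1))"
    using Suc by simp
  also have "\<dots> = (catalan n)\<^sup>2 * (16 * (real n + 1)\<^sup>2 * (4 * real n + 1))"
    by simp
  also have "\<dots> \<le> (catalan n)\<^sup>2 * ((4 * real n + 2)\<^sup>2 * (4 * real n + 5))"
    by (intro mult_left_mono) (simp_all add: power2_eq_square algebra_simps)
  also have "\<dots> = (catalan (Suc n))\<^sup>2 * (real (Suc n) + 1)\<^sup>2 * (4 * real (Suc n) + 1)"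
    by (simp add: divide_simps power2_eq_square add_ac)
  finally show ?case .
qed simp

text \<open>The growth bounds give the ratio at most 16 (ab/(a+b))^(3/2), and ab is at most
  (a+b)^2/4, which yields the constant 2. The computation is done on squares.\<close>

lemma catalan_merge:
  assumes "0 < a" "0 < b"
  shows "catalan (a + b - 1) \<le> 2 * real (a + b) powr (3 / 2) * (catalan (a - 1) * catalan (b - 1))"
proof (rule power2_le_imp_le)
  obtain m n where mn: "a = Suc m" "b = Suc n"
    using assms by (metis gr0_implies_Suc)
  have low: "16 ^ m \<le> 4 * ((catalan m)\<^sup>2 * real (Suc m) ^ 3)" for m
  proof -
    have "16 ^ m \<le> (catalan m)\<^sup>2 * (real m + 1)\<^sup>2 * (4 * real m + 1)"
      by (rule catalan_lower)
    also have "\<dots> \<le> (catalan m)\<^sup>2 * (real m + 1)\<^sup>2 * (4 * (real m + 1))"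
      by (intro mult_left_mono) auto
    finally show ?thesis
      by (simp add: power2_eq_square power3_eq_cube algebra_simps)
  qed
  define P where "P = (catalan m)\<^sup>2 * (catalan n)\<^sup>2"
  have P: "P \<ge> 0"
    by (simp add: P_def)
  have "4 * (real a * real b) \<le> (real (a + b))\<^sup>2"
    using sum_squares_ge_zero[of "real a - real b" 0] by (simp add: power2_eq_square algebra_simps)
  then have "(4 * (real a * real b)) ^ 3 \<le> ((real (a + b))\<^sup>2) ^ 3"
    by (intro power_mono) auto
  then have amgm: "64 * (real a * real b) ^ 3 \<le> real (a + b) ^ 6"
    by (simp add: power_mult_distrib power_mult[symmetric])
  have "(catalan (a + b - 1))\<^sup>2 * real (a + b) ^ 3 \<le> 16 ^ (Suc m + n)"
    using catalan_upper[of "Suc m + n"] mn by (simp add: add_ac)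
  also have "\<dots> = 16 * (16 ^ m * 16 ^ n)"
    by (simp add: power_add)
  also have "\<dots> \<le> 16 * ((4 * ((catalan m)\<^sup>2 * real a ^ 3)) * (4 * ((catalan n)\<^sup>2 * real b ^ 3)))"
    using low[of m] low[of n] mn by (intro mult_left_mono mult_mono) auto
  also have "\<dots> = 4 * P * (64 * (real a * real b) ^ 3)"
    by (simp add: P_def power_mult_distrib mult_ac)
  also have "\<dots> \<le> 4 * P * real (a + b) ^ 6"
    using amgm P by (intro mult_left_mono) auto
  also have "\<dots> = (4 * P * real (a + b) ^ 3) * real (a + b) ^ 3"
    by (simp add: power_add[symmetric])
  finally have "(catalan (a + b - 1))\<^sup>2 \<le> 4 * P * real (a + b) ^ 3"
    using assms by simp
  moreover have "(real (a + b) powr (3 / 2))\<^sup>2 = real (a + b) ^ 3"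
    using assms by (simp add: powr_power)
  ultimately show "(catalan (a + b - 1))\<^sup>2
      \<le> (2 * real (a + b) powr (3 / 2) * (catalan (a - 1) * catalan (b - 1)))\<^sup>2"
    using mn by (simp add: P_def power_mult_distrib mult_ac)
  show "0 \<le> 2 * real (a + b) powr (3 / 2) * (catalan (a - 1) * catalan (b - 1))"
    using catalan_pos by (intro mult_nonneg_nonneg less_imp_le[OF catalan_pos]) auto
qed

section \<open>Counting walks\<close>

text \<open>Indexed by the total number of steps, which drops by one along either kind of arrow; the
  number of solid arrows does not.\<close>

definition walks :: "nat \<Rightarrow> vertex \<Rightarrow> vertex list set" where
  "walks m u = {p. length p = Suc m \<and> set p \<subseteq> weingarten_vertices \<and> hd p = u \<and>
     last p = (0, id) \<and> successively weingarten_arrow p}"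

lemma weingarten_paths_eq_walks: "weingarten_paths k s l = walks (k + l) (k, s)"
  by (simp add: weingarten_paths_def walks_def add_ac)

lemma finite_walks: "finite (walks m u)"
proof (cases u)
  case (Pair k s)
  let ?V = "Sigma {..k} (\<lambda>j. {s. s permutes {1..j}})"
  show ?thesis
  proof (rule finite_subset)
    show "walks m u \<subseteq> {p. set p \<subseteq> ?V \<and> length p = Suc m}"
      using successively_weingarten_level Pair
      by (fastforce simp: walks_def weingarten_vertices_def)
    show "finite {p. set p \<subseteq> ?V \<and> length p = Suc m}"
      by (intro finite_lists_length_eq finite_SigmaI finite_permutations) auto
  qed
qed

lemma walks_0: "walks 0 u = (if u = (0, id) then {[u]} else {})"
  by (auto simp: walks_def length_Suc_conv weingarten_vertices_def permutes_id)

lemma walks_Suc: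
  assumes "u \<in> weingarten_vertices"
  shows "walks (Suc m) u = (\<Union>v\<in>{v. weingarten_arrow u v}. (#) u ` walks m v)"
proof (intro equalityI subsetI)
  fix p assume "p \<in> walks (Suc m) u"
  then obtain q where "p = u # q" "q \<noteq> []" "q \<in> walks m (hd q)" "weingarten_arrow u (hd q)"
    by (auto simp: walks_def length_Suc_conv)
  then show "p \<in> (\<Union>v\<in>{v. weingarten_arrow u v}. (#) u ` walks m v)"
    by blast
qed (use assms in \<open>auto simp: walks_def successively_Cons\<close>)

lemma card_walks_Suc:
  assumes "u \<in> weingarten_vertices" "finite {v. weingarten_arrow u v}"
  shows "card (walks (Suc m) u) = (\<Sum>v | weingarten_arrow u v. card (walks m v))"
proof -
  have "card (walks (Suc m) u) = (\<Sum>v | weingarten_arrow u v. card ((#) u ` walks m v))"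
    unfolding walks_Suc[OF assms(1)]
  proof (rule card_UN_disjoint)
    show "\<forall>v\<in>{v. weingarten_arrow u v}. finite ((#) u ` walks m v)"
      by (simp add: finite_walks)
  qed (use assms in \<open>auto simp: walks_def\<close>)
  also have "\<dots> = (\<Sum>v | weingarten_arrow u v. card (walks m v))"
    by (simp add: card_image)
  finally show ?thesis .
qed

lemma weingarten_arrows:
  assumes "s permutes {1..k}" "1 \<le> k"
  shows "{v. weingarten_arrow (k, s) v} =
    (\<lambda>i. (k, transpose i k \<circ> s)) ` {1..<k} \<union> (if s k = k then {(k - 1, s)} else {})"
proof -
  have solid: "solid_arrow (k, s) v \<longleftrightarrow> v \<in> (\<lambda>i. (k, transpose i k \<circ> s)) ` {1..<k}" for v
    using assms by (auto simp: solid_arrow.simps)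
  \<comment> \<open>Both functions are the identity outside \<open>{1..k - 1}\<close>, so a dashed
    arrow changes only the level.\<close>
  have "restrict_id s {1..k - 1} = s" if "s k = k"
  proof
    fix x
    show "restrict_id s {1..k - 1} x = s x"
      using permutes_not_in[OF assms(1), of x] that assms(2)
      by (cases "x = k") (auto simp: restrict_id_def)
  qed
  then have dashed: "dashed_arrow (k, s) v \<longleftrightarrow> s k = k \<and> v = (k - 1, s)" for v
    using assms by (auto simp: dashed_arrow.simps)
  show ?thesis
    by (auto simp: weingarten_arrow_def solid dashed)
qed

definition num_walks :: "nat \<Rightarrow> nat \<Rightarrow> (nat \<Rightarrow> nat) \<Rightarrow> real" where
  "num_walks m k s = real (card (walks m (k, s)))"

lemma num_walks_0: "num_walks m 0 id = (if m = 0 then 1 else 0)"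
proof (cases m)
  case (Suc m')
  have "{v. weingarten_arrow (0, id) v} = {}"
    by (auto simp: weingarten_arrow_def solid_arrow.simps dashed_arrow.simps)
  then have "walks m (0, id) = {}"
    using walks_Suc[of "(0, id)" m'] by (simp add: Suc weingarten_vertices_def permutes_id)
  then show ?thesis
    by (simp add: num_walks_def Suc)
qed (simp add: num_walks_def walks_0)

lemma num_walks_Suc:
  assumes "s permutes {1..k}" "1 \<le> k"
  shows "num_walks (Suc m) k s =
    (\<Sum>i\<in>{1..<k}. num_walks m k (transpose i k \<circ> s)) + (if s k = k then num_walks m (k - 1) s else 0)"
proof -
  have inj: "inj_on (\<lambda>i. (k, transpose i k \<circ> s)) {1..<k}"
  proof (rule inj_onI)
    fix i j assume "(k, transpose i k \<circ> s) = (k, transpose j k \<circ> s)"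
    \<comment> \<open>At the preimage of \<open>k\<close> the two products take the values
      \<open>i\<close> and \<open>j\<close>.\<close>
    then have "transpose i k (s (inv s k)) = transpose j k (s (inv s k))"
      by (metis comp_apply prod.inject)
    then show "i = j"
      by (simp add: permutes_inverses(1)[OF assms(1)])
  qed
  have "card (walks (Suc m) (k, s)) = (\<Sum>v | weingarten_arrow (k, s) v. card (walks m v))"
    by (rule card_walks_Suc) (use assms in \<open>auto simp: weingarten_vertices_def weingarten_arrows\<close>)
  also have "\<dots> = (\<Sum>v\<in>(\<lambda>i. (k, transpose i k \<circ> s)) ` {1..<k}. card (walks m v)) +
      (\<Sum>v\<in>(if s k = k then {(k - 1, s)} else {}). card (walks m v))"
    unfolding weingarten_arrows[OF assms] using assms(2) by (intro sum.union_disjoint) auto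
  also have "\<dots> = (\<Sum>i\<in>{1..<k}. card (walks m (k, transpose i k \<circ> s))) +
      (if s k = k then card (walks m (k - 1, s)) else 0)"
    using inj by (simp add: sum.reindex)
  finally show ?thesis
    by (simp add: num_walks_def)
qed

section \<open>Effect of the arrows on the rank\<close>

definition rank :: "nat \<Rightarrow> (nat \<Rightarrow> nat) \<Rightarrow> nat" where
  "rank k s = 2 * k - card (orbit s ` {1..k})"

lemma rank_eq: "s permutes {1..k} \<Longrightarrow> rank k s = k + perm_length k s"
  using num_cycles_le[of k s]
  using cycles_eq_orbits[of s k] by (simp add: rank_def perm_length_def num_cycles_def)

lemma card_orbits_le: "card (orbit s ` {1..k}) \<le> k"
  using card_image_le[of "{1..k}" "orbit s"] by simp

lemma rank_0: "rank 0 s = 0"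
  by (simp add: rank_def)

lemma rank_pos: "1 \<le> k \<Longrightarrow> 0 < rank k s"
  using card_orbits_le[of s k] by (simp add: rank_def)

lemma transpose_comp_permutes:
  fixes k :: nat
  assumes "s permutes {1..k}" "i \<in> {1..<k}"
  shows "(transpose i k \<circ> s) permutes {1..k}"
  using assms by (intro permutes_compose permutes_swap_id) auto

lemma rank_split:
  assumes "s permutes {1..k}" "i \<in> {1..<k}" "i \<in> orbit s k"
  shows "Suc (rank k (transpose i k \<circ> s)) = rank k s"
proof -
  have "permutation s"
    using assms(1) by (auto simp: permutation_permutes)
  then obtain j where j: "j < card (orbit s k)" "i = (s ^^ j) k"
    using assms(3) orbit_funpow_card(3)[of s k] by auto
  then have "0 < j"
    using assms(2) by (cases j) auto
  then have "card (orbit (transpose i k \<circ> s) ` {1..k}) = Suc (card (orbit s ` {1..k}))"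
    using assms j by (intro split_cycle) auto
  \<comment> \<open>The bound on the number of orbits keeps the natural subtraction in
    \<open>rank\<close> exact.\<close>
  then show ?thesis
    using card_orbits_le[of "transpose i k \<circ> s" k] assms(2) by (simp add: rank_def)
qed

lemma rank_merge:
  assumes "s permutes {1..k}" "i \<in> {1..<k}" "i \<notin> orbit s k"
  shows "rank k (transpose i k \<circ> s) = Suc (rank k s)"
proof -
  have "Suc (card (orbit (transpose i k \<circ> s) ` {1..k})) = card (orbit s ` {1..k})"
    using assms by (intro merge_cycles) auto
  then show ?thesis
    using card_orbits_le[of s k] assms(2) by (simp add: rank_def)
qed

lemma permutes_fixed_last:
  fixes k :: nat
  assumes "s permutes {1..k}" "s k = k"
  shows "s permutes {1..k - 1}"
proof (rule permutes_superset[OF assms(1)])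
  fix x assume "x \<in> {1..k} - {1..k - 1}"
  then have "x = k" by auto
  then show "s x = x" using assms(2) by simp
qed

lemma orbits_fixed_last:
  fixes k :: nat
  assumes "s permutes {1..k}" "1 \<le> k" "s k = k"
  shows "orbit s ` {1..k} = insert {k} (orbit s ` {1..k - 1})"
    and "{k} \<notin> orbit s ` {1..k - 1}"
proof -
  have "{1..k} = insert k {1..k - 1}"
    using assms(2) by auto
  moreover have "orbit s k = {k}"
    using assms(3) by (simp add: orbit_eq_singleton_iff)
  ultimately show "orbit s ` {1..k} = insert {k} (orbit s ` {1..k - 1})"
    by simp
  show "{k} \<notin> orbit s ` {1..k - 1}"
    using permutes_orbit_subset[OF permutes_fixed_last[OF assms(1,3)]] assms(2) by fastforce
qed

lemma rank_fixed_last: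
  assumes "s permutes {1..k}" "1 \<le> k" "s k = k"
  shows "Suc (rank (k - 1) s) = rank k s"
  using orbits_fixed_last[OF assms] card_orbits_le[of s "k - 1"] assms(2)
  by (simp add: rank_def)

text \<open>An arrow lowers the rank by at most one, and the end vertex has rank 0.\<close>

lemma num_walks_below_rank:
  assumes "s permutes {1..k}" "m < rank k s"
  shows "num_walks m k s = 0"
  using assms
proof (induction m arbitrary: k s)
  case 0
  then have "k \<noteq> 0"
    by (cases k) (auto simp: rank_0)
  then show ?case
    by (simp add: num_walks_def walks_0)
next
  case (Suc m)
  show ?case
  proof (cases "k = 0")
    case False
    then have k: "1 \<le> k" by simp
    have "num_walks m k (transpose i k \<circ> s) = 0" if "i \<in> {1..<k}" for i
    proof (rule Suc.IH[OF transpose_comp_permutes[OF Suc.prems(1) that]])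
      show "m < rank k (transpose i k \<circ> s)"
        using Suc.prems(2) rank_split[OF Suc.prems(1) that] rank_merge[OF Suc.prems(1) that]
        by (cases "i \<in> orbit s k") auto
    qed
    moreover have "num_walks m (k - 1) s = 0" if "s k = k"
      using Suc.IH[OF permutes_fixed_last[OF Suc.prems(1) that]]
        rank_fixed_last[OF Suc.prems(1) k that] Suc.prems(2) by simp
    ultimately show ?thesis
      by (simp add: num_walks_Suc[OF Suc.prems(1) k])
  qed (use Suc.prems rank_0 in auto)
qed

text \<open>Separates the steps that lower the rank (first two summands) from those that raise
  it.\<close>

lemma num_walks_split_merge:
  assumes "s permutes {1..k}" "1 \<le> k"
  shows "num_walks (Suc m) k s =
    (\<Sum>i\<in>{i \<in> {1..<k}. i \<in> orbit s k}. num_walks m k (transpose i k \<circ> s)) +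
    (if s k = k then num_walks m (k - 1) s else 0) +
    (\<Sum>i\<in>{i \<in> {1..<k}. i \<notin> orbit s k}. num_walks m k (transpose i k \<circ> s))"
proof -
  have "{1..<k} = {i \<in> {1..<k}. i \<in> orbit s k} \<union> {i \<in> {1..<k}. i \<notin> orbit s k}"
    by auto
  then have "(\<Sum>i\<in>{1..<k}. num_walks m k (transpose i k \<circ> s)) =
    (\<Sum>i\<in>{i \<in> {1..<k}. i \<in> orbit s k}. num_walks m k (transpose i k \<circ> s)) +
    (\<Sum>i\<in>{i \<in> {1..<k}. i \<notin> orbit s k}. num_walks m k (transpose i k \<circ> s))"
    by (metis (no_types, lifting) sum.union_disjoint finite_atLeastLessThan finite_Un
        disjoint_iff mem_Collect_eq)
  then show ?thesis
    by (simp add: num_walks_Suc[OF assms])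
qed

section \<open>Catalan products and the number of shortest walks\<close>

abbreviation catalan_prod :: "nat \<Rightarrow> (nat \<Rightarrow> nat) \<Rightarrow> real" where
  "catalan_prod k s \<equiv> cycle_prod (\<lambda>n. catalan (n - 1)) s {1..k}"

lemma catalan_prod_pos: "catalan_prod k s > 0"
  unfolding cycle_prod_def by (intro prod_pos) (simp add: catalan_pos)

text \<open>The lost fixed point contributes \<open>catalan 0 = 1\<close>.\<close>

lemma catalan_prod_fixed_last:
  assumes "s permutes {1..k}" "1 \<le> k" "s k = k"
  shows "catalan_prod k s = catalan_prod (k - 1) s"
  unfolding cycle_prod_def orbits_fixed_last(1)[OF assms]
  using orbits_fixed_last(2)[OF assms] by simp

text \<open>If the cycle of \<open>k\<close> has length m+2, its point at index j+1 cuts it into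
  lengths j+1 and m+1-j, replacing the factor \<open>catalan (Suc m)\<close> by
  \<open>catalan j * catalan (m - j)\<close>. Summing over j is the Catalan recursion.\<close>

lemma catalan_prod_split_sum:
  assumes s: "s permutes {1..k}" and k: "1 \<le> k" "s k \<noteq> k"
  shows "(\<Sum>i\<in>{i \<in> {1..<k}. i \<in> orbit s k}. catalan_prod k (transpose i k \<circ> s)) = catalan_prod k s"
proof -
  define n where "n = card (orbit s k)"
  have perm: "permutation s"
    using s by (auto simp: permutation_permutes)
  have fin: "finite (orbit s k)"
    using finite_orbit[OF permutation_self_in_orbit[OF perm]] .
  have "card {k, s k} \<le> n"
    unfolding n_def using fin permutation_self_in_orbit[OF perm]
    by (intro card_mono) (auto intro: orbit.base)
  then have "2 \<le> n"
    using k by simp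
  then obtain m where m: "n = Suc (Suc m)"
    by (metis add_2_eq_Suc le_Suc_ex)
  have bij: "bij_betw (\<lambda>j. (s ^^ Suc j) k) {..m} {i \<in> {1..<k}. i \<in> orbit s k}"
  proof (rule bij_betw_imageI)
    show "inj_on (\<lambda>j. (s ^^ Suc j) k) {..m}"
      using orbit_funpow_card(2)[OF perm, of k] m unfolding n_def inj_on_def
      by (metis Suc_inject Suc_less_eq atMost_iff le_imp_less_Suc lessThan_iff)
    have "{i \<in> {1..<k}. i \<in> orbit s k} = orbit s k - {k}"
      using permutes_orbit_subset[OF s, of k] k by fastforce
    also have "\<dots> = (\<lambda>j. (s ^^ j) k) ` {..<n} - {k}"
      using orbit_funpow_card(3)[OF perm, of k] by (simp add: n_def)
    also have "{..<n} = insert 0 (Suc ` {..m})"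
      unfolding m lessThan_Suc_eq_insert_0[of "Suc m"] by (simp only: lessThan_Suc_atMost)
    also have "(\<lambda>j. (s ^^ j) k) ` insert 0 (Suc ` {..m}) - {k} = (\<lambda>j. (s ^^ Suc j) k) ` {..m}"
    proof -
      have "(s ^^ Suc j) k \<noteq> k" if "j \<le> m" for j
        using inj_onD[OF orbit_funpow_card(2)[OF perm, of k], of "Suc j" 0] that m
        by (auto simp: n_def simp del: funpow.simps(2))
      then show ?thesis
        by (auto simp: image_image simp del: funpow.simps(2))
    qed
    finally show "(\<lambda>j. (s ^^ Suc j) k) ` {..m} = {i \<in> {1..<k}. i \<in> orbit s k}" ..
  qed
  have "(\<Sum>i\<in>{i \<in> {1..<k}. i \<in> orbit s k}. catalan_prod k (transpose i k \<circ> s))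
      = (\<Sum>j\<le>m. catalan_prod k (transpose ((s ^^ Suc j) k) k \<circ> s))"
    by (rule sum.reindex_bij_betw[OF bij, symmetric])
  also have "\<dots> = (\<Sum>j\<le>m. catalan j * catalan (m - j) * (catalan_prod k s / catalan (Suc m)))"
  proof (rule sum.cong)
    fix j assume "j \<in> {..m}"
    then have "catalan (n - 1) * catalan_prod k (transpose ((s ^^ Suc j) k) k \<circ> s)
      = catalan (Suc j - 1) * catalan (n - Suc j - 1) * catalan_prod k s"
      unfolding n_def using s k m by (intro split_cycle) (auto simp: n_def)
    then show "catalan_prod k (transpose ((s ^^ Suc j) k) k \<circ> s)
      = catalan j * catalan (m - j) * (catalan_prod k s / catalan (Suc m))"
      using catalan_pos[of "Suc m"] by (simp add: m eq_divide_eq mult_ac del: catalan.simps)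
  qed simp
  also have "\<dots> = catalan (Suc m) * (catalan_prod k s / catalan (Suc m))"
    by (simp only: sum_distrib_right[symmetric] catalan_Suc_convolution[symmetric])
  also have "\<dots> = catalan_prod k s"
    using catalan_pos[of "Suc m"] by (simp del: catalan.simps)
  finally show ?thesis .
qed

text \<open>Both sides satisfy the same recursion: splittings by
  \<open>catalan_prod_split_sum\<close>, a dashed arrow by
  \<open>catalan_prod_fixed_last\<close>.\<close>

lemma num_walks_rank:
  assumes "s permutes {1..k}"
  shows "num_walks (rank k s) k s = catalan_prod k s"
  using assms
proof (induction "rank k s" arbitrary: k s)
  case 0
  then have "k = 0"
    using rank_pos[of k s] by fastforce
  then show ?case
    using 0 by (simp add: num_walks_0[unfolded id_def] rank_0 cycle_prod_def)
next
  case (Suc m)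
  then have k: "1 \<le> k"
    using rank_0[of s] by (cases k) auto
  \<comment> \<open>A merge raises the rank to m+2 while only m steps remain.\<close>
  have merge: "num_walks m k (transpose i k \<circ> s) = 0" if "i \<in> {1..<k}" "i \<notin> orbit s k" for i
    using that Suc.prems Suc.hyps(2) rank_merge[OF Suc.prems that]
    by (intro num_walks_below_rank transpose_comp_permutes) auto
  have split: "num_walks m k (transpose i k \<circ> s) = catalan_prod k (transpose i k \<circ> s)"
    if "i \<in> {1..<k}" "i \<in> orbit s k" for i
  proof -
    have "m = rank k (transpose i k \<circ> s)"
      using rank_split[OF Suc.prems that] Suc.hyps(2) by simp
    then show ?thesis
      using Suc.hyps(1) transpose_comp_permutes[OF Suc.prems that(1)] by blast
  qed
  have eq: "num_walks (rank k s) k s =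
      (\<Sum>i\<in>{i \<in> {1..<k}. i \<in> orbit s k}. catalan_prod k (transpose i k \<circ> s)) +
      (if s k = k then num_walks m (k - 1) s else 0)"
    using num_walks_split_merge[OF Suc.prems k, of m] Suc.hyps(2) merge split by simp
  show ?case
  proof (cases "s k = k")
    case True
    then have "orbit s k = {k}"
      by (simp add: orbit_eq_singleton_iff)
    then have "{i \<in> {1..<k}. i \<in> orbit s k} = {}"
      by auto
    then have "num_walks (rank k s) k s = num_walks m (k - 1) s"
      using eq True by (simp only: sum.empty) simp
    also have "\<dots> = catalan_prod (k - 1) s"
    proof -
      have "m = rank (k - 1) s"
        using rank_fixed_last[OF Suc.prems k True] Suc.hyps(2) by simp
      then show ?thesis
        using Suc.hyps(1) permutes_fixed_last[OF Suc.prems True] by blast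
    qed
    finally show ?thesis
      using catalan_prod_fixed_last[OF Suc.prems k True] by simp
  next
    case False
    then show ?thesis
      using eq catalan_prod_split_sum[OF Suc.prems k False] by simp
  qed
qed

section \<open>Cost of a merging step and the upper bound\<close>

lemma catalan_prod_merge:
  fixes k :: nat and s :: "nat \<Rightarrow> nat"
  assumes s: "s permutes {1..k}" and i: "i \<in> {1..<k}" "i \<notin> orbit s k"
  shows "catalan_prod k (transpose i k \<circ> s) \<le> 2 * real k powr (3 / 2) * catalan_prod k s"
proof -
  let ?t = "transpose i k \<circ> s"
  \<comment> \<open>The merge exchanges the factors of cycles of lengths \<open>a\<close> and
    \<open>b\<close> for that of one cycle of length \<open>a + b\<close>.\<close>
  obtain a b where ab: "0 < a" "0 < b" "a + b \<le> k"
    "catalan (a + b - 1) * catalan_prod k s = catalan (a - 1) * catalan (b - 1) * catalan_prod k ?t"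
    using merge_cycles(2)[OF s, where x = k and i = i and f = "\<lambda>n. catalan (n - 1)"] i by auto
  let ?c = "catalan (a - 1) * catalan (b - 1)"
  have c: "?c > 0"
    by (simp add: catalan_pos)
  have "?c * catalan_prod k ?t = catalan (a + b - 1) * catalan_prod k s"
    using ab(4) by simp
  also have "\<dots> \<le> (2 * real (a + b) powr (3 / 2) * ?c) * catalan_prod k s"
    using catalan_merge[OF ab(1,2)] catalan_prod_pos[of s k] by (intro mult_right_mono) auto
  also have "\<dots> \<le> (2 * real k powr (3 / 2) * ?c) * catalan_prod k s"
    using ab(3) catalan_prod_pos[of s k] c
    by (intro mult_right_mono mult_left_mono powr_mono2) auto
  finally have "?c * catalan_prod k ?t \<le> ?c * (2 * real k powr (3 / 2) * catalan_prod k s)"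
    by (simp add: mult_ac)
  then show ?thesis
    using c by (rule mult_left_le_imp_le)
qed

lemma catalan_prod_merge_sum:
  fixes k :: nat and s :: "nat \<Rightarrow> nat"
  assumes s: "s permutes {1..k}" and k: "1 \<le> k"
  shows "(\<Sum>i\<in>{i \<in> {1..<k}. i \<notin> orbit s k}. catalan_prod k (transpose i k \<circ> s))
    \<le> 2 * real k powr (5 / 2) * catalan_prod k s"
proof -
  let ?B = "2 * real k powr (3 / 2) * catalan_prod k s"
  have B: "0 \<le> ?B"
    using catalan_prod_pos[of s k] by simp
  have "(\<Sum>i\<in>{i \<in> {1..<k}. i \<notin> orbit s k}. catalan_prod k (transpose i k \<circ> s))
      \<le> real (card {i \<in> {1..<k}. i \<notin> orbit s k}) * ?B"
    using catalan_prod_merge[OF s] by (intro sum_bounded_above) auto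
  also have "\<dots> \<le> real k * ?B"
  proof (intro mult_right_mono B)
    have "card {i \<in> {1..<k}. i \<notin> orbit s k} \<le> card {1..<k}"
      by (intro card_mono) auto
    then show "real (card {i \<in> {1..<k}. i \<notin> orbit s k}) \<le> real k"
      by simp
  qed
  also have "real k * real k powr (3 / 2) = real k powr (5 / 2)"
    using k powr_add[of "real k" 1 "3 / 2"] by simp
  then have "real k * ?B = 2 * real k powr (5 / 2) * catalan_prod k s"
    by (simp add: mult_ac)
  finally show ?thesis .
qed

text \<open>The level drops along dashed arrows, so a fixed \<open>n\<close> above all levels keeps
  the constant the same throughout the induction.\<close>

lemma num_walks_upper:
  assumes "s permutes {1..k}" "k \<le> n"
  shows "num_walks (rank k s + 2 * g) k s \<le> (6 * real n powr (7 / 2)) ^ g * catalan_prod k s"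
  using assms
proof (induction g arbitrary: k s)
  case 0
  then show ?case
    by (simp add: num_walks_rank)
next
  case (Suc g)
  note IH = Suc.IH
  let ?K = "6 * real n powr (7 / 2)"
  \<comment> \<open>\<open>L\<close> bounds the relative cost of merging at once: all choices of
    \<open>i\<close> together, times the outer induction hypothesis for the rest of the
    walk.\<close>
  define L where "L = 2 * real n powr (5 / 2) * ?K ^ g"
  have L: "0 \<le> L"
    by (simp add: L_def)
  \<comment> \<open>Inner induction on the rank, which bounds the number of positions of the first
    merge. The rank-lowering steps together preserve the Catalan product, and merging at the current
    vertex adds one \<open>L\<close>.\<close>
  have claim: "num_walks (rank k s + 2 * Suc g) k s \<le> real (rank k s) * L * catalan_prod k s"
    if "s permutes {1..k}" "k \<le> n" for k s
    using that
  proof (induction "rank k s" arbitrary: k s)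
    case 0
    then have "k = 0"
      using rank_pos[of k s] by fastforce
    then show ?case
      using 0 by (simp add: num_walks_0[unfolded id_def] rank_0)
  next
    case (Suc m)
    note s = Suc.prems(1)
    have k: "1 \<le> k"
      using Suc.hyps(2) rank_0[of s] by (cases k) auto
    let ?m = "m + 2 * Suc g"
    have split: "num_walks ?m k (transpose i k \<circ> s) \<le> real m * L * catalan_prod k (transpose i k \<circ> s)"
      if "i \<in> {1..<k}" "i \<in> orbit s k" for i
    proof -
      have "m = rank k (transpose i k \<circ> s)"
        using rank_split[OF s that] Suc.hyps(2) by simp
      then show ?thesis
        using Suc.hyps(1) transpose_comp_permutes[OF s that(1)] Suc.prems(2) by blast
    qed
    have "(\<Sum>i\<in>{i \<in> {1..<k}. i \<in> orbit s k}. num_walks ?m k (transpose i k \<circ> s)) +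
        (if s k = k then num_walks ?m (k - 1) s else 0) \<le> real m * L * catalan_prod k s"
    proof (cases "s k = k")
      case True
      then have "orbit s k = {k}"
        by (simp add: orbit_eq_singleton_iff)
      then have "{i \<in> {1..<k}. i \<in> orbit s k} = {}"
        by auto
      moreover have "num_walks ?m (k - 1) s \<le> real m * L * catalan_prod (k - 1) s"
      proof -
        have "m = rank (k - 1) s" "k - 1 \<le> n"
          using rank_fixed_last[OF s k True] Suc.hyps(2) Suc.prems(2) by simp_all
        then show ?thesis
          using Suc.hyps(1) permutes_fixed_last[OF s True] by blast
      qed
      ultimately show ?thesis
        using True catalan_prod_fixed_last[OF s k True] by (simp only: sum.empty) simp
    next
      case False
      have "(\<Sum>i\<in>{i \<in> {1..<k}. i \<in> orbit s k}. num_walks ?m k (transpose i k \<circ> s))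
          \<le> (\<Sum>i\<in>{i \<in> {1..<k}. i \<in> orbit s k}. real m * L * catalan_prod k (transpose i k \<circ> s))"
        using split by (intro sum_mono) auto
      also have "\<dots> = real m * L * catalan_prod k s"
        by (simp only: sum_distrib_left[symmetric] catalan_prod_split_sum[OF s k False])
      finally show ?thesis
        using False by simp
    qed
    moreover have "(\<Sum>i\<in>{i \<in> {1..<k}. i \<notin> orbit s k}. num_walks ?m k (transpose i k \<circ> s))
        \<le> L * catalan_prod k s"
    proof -
      have "num_walks ?m k (transpose i k \<circ> s) \<le> ?K ^ g * catalan_prod k (transpose i k \<circ> s)"
        if "i \<in> {1..<k}" "i \<notin> orbit s k" for i
      proof -
        \<comment> \<open>After the merge the rank is m+2, so the excess over it falls from
          \<open>2 * Suc g\<close> to \<open>2 * g\<close>.\<close>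
        have "?m = rank k (transpose i k \<circ> s) + 2 * g"
          using rank_merge[OF s that] Suc.hyps(2) by simp
        then show ?thesis
          using IH[OF transpose_comp_permutes[OF s that(1)] Suc.prems(2)] by (simp only:)
      qed
      then have "(\<Sum>i\<in>{i \<in> {1..<k}. i \<notin> orbit s k}. num_walks ?m k (transpose i k \<circ> s))
          \<le> (\<Sum>i\<in>{i \<in> {1..<k}. i \<notin> orbit s k}. ?K ^ g * catalan_prod k (transpose i k \<circ> s))"
        by (intro sum_mono) auto
      also have "\<dots> \<le> ?K ^ g * (2 * real k powr (5 / 2) * catalan_prod k s)"
        unfolding sum_distrib_left[symmetric]
        using catalan_prod_merge_sum[OF s k] by (intro mult_left_mono) auto
      also have "\<dots> \<le> ?K ^ g * (2 * real n powr (5 / 2) * catalan_prod k s)"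
        using Suc.prems(2) catalan_prod_pos[of s k]
        by (intro mult_left_mono mult_right_mono powr_mono2) auto
      finally show ?thesis
        by (simp add: L_def mult_ac)
    qed
    ultimately have "num_walks (Suc ?m) k s \<le> real m * L * catalan_prod k s + L * catalan_prod k s"
      using num_walks_split_merge[OF s k, of ?m] Suc.hyps(2) by simp
    then show ?case
      using Suc.hyps(2)[symmetric] by (simp add: algebra_simps)
  qed
  have "num_walks (rank k s + 2 * Suc g) k s \<le> real (rank k s) * L * catalan_prod k s"
    using Suc.prems by (rule claim)
  also have "\<dots> \<le> 2 * real n * L * catalan_prod k s"
    using Suc.prems L catalan_prod_pos[of s k]
    by (intro mult_right_mono) (auto simp: rank_def)
  also have "2 * real n * L \<le> ?K ^ Suc g"
  proof -
    have "real n * real n powr (5 / 2) = real n powr (7 / 2)"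
      using powr_add[of "real n" 1 "5 / 2"] by (cases "n = 0") auto
    \<comment> \<open>The argument yields the constant 4, within the stated 6.\<close>
    then have "2 * real n * L = 4 * real n powr (7 / 2) * ?K ^ g"
      by (simp add: L_def mult_ac)
    also have "\<dots> \<le> ?K * ?K ^ g"
      by (intro mult_right_mono) auto
    finally show ?thesis
      by simp
  qed
  then have "2 * real n * L * catalan_prod k s \<le> ?K ^ Suc g * catalan_prod k s"
    using catalan_prod_pos[of s k] by (intro mult_right_mono) auto
  finally show ?case .
qed

section \<open>Detours and the lower bound\<close>

lemma num_walks_add_2:
  assumes s: "s permutes {1..k}" and k: "1 \<le> k"
  shows "(real k - 1) * num_walks m k s \<le> num_walks (Suc (Suc m)) k s"
proof -
  have nonneg: "0 \<le> num_walks m j t" for m j t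
    by (simp add: num_walks_def)
  have "num_walks m k s \<le> num_walks (Suc m) k (transpose i k \<circ> s)" if i: "i \<in> {1..<k}" for i
  proof -
    have "num_walks m k s = num_walks m k (transpose i k \<circ> (transpose i k \<circ> s))"
      by (simp add: comp_assoc[symmetric])
    \<comment> \<open>The summand \<open>j = i\<close> is the return to \<open>s\<close>; the others
      are nonnegative.\<close>
    also have "\<dots> \<le> (\<Sum>j\<in>{1..<k}. num_walks m k (transpose j k \<circ> (transpose i k \<circ> s)))"
      using i nonneg
      by (intro member_le_sum[where f = "\<lambda>j. num_walks m k (transpose j k \<circ> (transpose i k \<circ> s))"]) auto
    also have "\<dots> \<le> num_walks (Suc m) k (transpose i k \<circ> s)"
      using num_walks_Suc[OF transpose_comp_permutes[OF s i] k, of m] nonneg by simp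
    finally show ?thesis .
  qed
  then have "real (card {1..<k}) * num_walks m k s
      \<le> (\<Sum>i\<in>{1..<k}. num_walks (Suc m) k (transpose i k \<circ> s))"
    by (intro sum_bounded_below) auto
  also have "\<dots> \<le> num_walks (Suc (Suc m)) k s"
    using num_walks_Suc[OF s k, of "Suc m"] nonneg by simp
  finally show ?thesis
    using k by (simp add: of_nat_diff)
qed

lemma num_walks_lower:
  assumes "s permutes {1..k}" "1 \<le> k"
  shows "(real k - 1) ^ g * num_walks m k s \<le> num_walks (m + 2 * g) k s"
proof (induction g)
  case (Suc g)
  have "(real k - 1) ^ Suc g * num_walks m k s = (real k - 1) * ((real k - 1) ^ g * num_walks m k s)"
    by simp
  also have "\<dots> \<le> (real k - 1) * num_walks (m + 2 * g) k s"
    using Suc assms(2) by (intro mult_left_mono) auto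
  also have "\<dots> \<le> num_walks (m + 2 * Suc g) k s"
    using num_walks_add_2[OF assms] by simp
  finally show ?case .
qed simp

theorem theorem3p1:
  fixes k g :: nat and \<sigma> :: "nat \<Rightarrow> nat"
  assumes "k \<ge> 1" and "\<sigma> permutes {1..k}"
  shows "(real k - 1) ^ g * real (card (weingarten_paths k \<sigma> (perm_length k \<sigma>)))
           \<le> real (card (weingarten_paths k \<sigma> (perm_length k \<sigma> + 2 * g))) \<and>
         real (card (weingarten_paths k \<sigma> (perm_length k \<sigma> + 2 * g)))
           \<le> (6 * real k powr (7 / 2)) ^ g
              * real (card (weingarten_paths k \<sigma> (perm_length k \<sigma>)))"
proof -
  \<comment> \<open>Adding the \<open>k\<close> dashed arrows to the solid ones gives
    \<open>rank k \<sigma> + l\<close> steps in total.\<close>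
  have "real (card (weingarten_paths k \<sigma> (perm_length k \<sigma> + l))) = num_walks (rank k \<sigma> + l) k \<sigma>" for l
    using assms by (simp add: weingarten_paths_eq_walks num_walks_def rank_eq add_ac)
  from this[of 0] this[of "2 * g"] show ?thesis
    using num_walks_lower[OF assms(2,1), of g "rank k \<sigma>"] num_walks_upper[OF assms(2) order_refl, of g]
    by (simp add: num_walks_rank[OF assms(2)])
qed

end
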